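(* Let $m,n,p$ be positive integers, let $L\in\mathbb{C}^{p\times p}$ be a doubly real-preserving transformation, and suppose that $\mathcal{A}\in\mathbb{K}_p^{m\times n}(L)$ has a T-SVD factorization $\mathcal{A}=\mathcal{U}*_L\mathcal{S}*_L\mathcal{V}^\top$ (so $\mathcal{S}=G(\mathcal{A})$). Then $\mathcal{S}=G(\mathcal{S})$. Moreover, if $L=F$ is the $p\times p$ discrete Fourier transform matrix or $L$ is real, then $\mathcal{S}$ is an s-diagonal tubal matrix.
   Context: For an invertible $L\in\mathbb{C}^{p\times p}$ put $\phi_L(\mathbf a)=L\mathbf a$, $\phi_L^{-1}(\mathbf a)=L^{-1}\mathbf a$ for $\mathbf a\in\mathbb{C}^p$, and $\mathbf a\odot_L\mathbf b=\phi_L^{-1}(\phi_L(\mathbf a)\circ\phi_L(\mathbf b))$, where $\circ$ is the Hadamard (entrywise) product. $\mathbf a(k)$ denotes the $k$th component. $L$ is real-preserving if $\mathbf a\odot_L\mathbf b\in\mathbb{R}^p$ for all $\mathbf a,\mathbf b\in\mathbb{R}^p$; then $\mathbb{K}_p=\mathbb{K}_p(L)=(\mathbb{R}^p,+,\odot_L)$ is a commutative ring with unit $\mathbf e_L$, whose elements are called tubal scalars. Let $\psi_L(\mathbf a)=\phi_L^{-1}(\overline{\phi_L(\mathbf a)})$. $L$ is doubly real-preserving if it is real-preserving and $\psi_L(\mathbf a)\in\mathbb{R}^p$ for all $\mathbf a\in\mathbb{R}^p$; then $\mathbf a^\top:=\psi_L(\mathbf a)$. A tubal scalar is symmetric if $\mathbf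 a^\top=\mathbf a$; a symmetric $\mathbf a$ is positive semi-definite if $\phi_L(\mathbf a)(k)\ge 0$ for all $k=1,\dots,p$. The DFT matrix is $F=(\omega^{(i-1)(j-1)})_{i,j=1}^p$ with $\omega=e^{-2\pi \mathrm{i}/p}$. $\mathbb{K}_p^{m\times n}=\mathbb{K}_p^{m\times n}(L)$ is the set of tubal matrices, i.e. $m\times n$ matrices $\mathcal{A}=(\mathbf a_{ij})$ with entries in $\mathbb{K}_p$. The product $\mathcal{A}*_L\mathcal{B}$ is the matrix product over $\mathbb{K}_p$: entry $(i,j)$ is $\sum_l\mathbf a_{il}\odot_L\mathbf b_{lj}$. The transpose $\mathcal{A}^\top\in\mathbb{K}_p^{n\times m}$ has $(i,j)$ entry $\mathbf a_{ji}^\top$. The identity tubal matrix has diagonal entries $\mathbf e_L$ and off-diagonal entries $\mathbf 0$; a square tubal matrix $\mathcal{A}$ is orthogonal if $\mathcal{A}^{-1}=\mathcal{A}^\top$. A tubal matrix is diagonal if all entries $\mathbf a_{ij}$, $i\neq j$, are $\mathbf 0$. For $\mathcal{A}=(\mathbf a_{ij})\in\mathbb{K}_p^{m\times n}$ let $\Phi_L(\mathcal{A})(k)=(\phi_L(\mathbf a_{ij})(k))\in\mathbb{C}^{m\times n}$, $k=1,\dots,p$, and let $\mathbf d_{11}(k)\ge\cdots\ge\mathbf d_{\min\{m,n\},\min\{m,n\}}(k)\ge0$ be the singular values of this matrix (with multiplicity, including zeros). Put $\mathbf d_{ll}=(\mathbf d_{ll}(1),\dots,\mathbf d_{ll}(p))$,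 $\mathbf s_{ll}=\phi_L^{-1}(\mathbf d_{ll})$. $G(\mathcal{A})$ is the diagonal $m\times n$ tubal matrix $\mathrm{diag}(\mathbf s_{11},\dots,\mathbf s_{\min\{m,n\},\min\{m,n\}})$. A T-SVD factorization of $\mathcal{A}$ is $\mathcal{A}=\mathcal{U}*_L\mathcal{S}*_L\mathcal{V}^\top$ with $\mathcal{U}\in\mathbb{K}_p^{m\times m}$, $\mathcal{V}\in\mathbb{K}_p^{n\times n}$ orthogonal tubal matrices and $\mathcal{S}=G(\mathcal{A})\in\mathbb{K}_p^{m\times n}$. A diagonal tubal matrix $\mathcal{A}=(\mathbf a_{ij})\in\mathbb{K}_p^{m\times n}$ is s-diagonal if (1) all its diagonal entries are symmetric; (2) all its diagonal entries are positive semi-definite; (3) for every $k=1,\dots,p$, $\phi_L(\mathbf a_{11})(k)\ge\phi_L(\mathbf a_{22})(k)\ge\cdots\ge\phi_L(\mathbf a_{\min\{m,n\},\min\{m,n\}})(k)$. *)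

theory Defs
  imports "HOL-Analysis.Analysis" "Jordan_Normal_Form.Schur_Decomposition"
begin

text \<open>
  Vectors and matrices are those of Jordan_Normal_Form, so all indices start at 0. The space R^p is taken as the set of complex vectors of dimension p with real
  entries; hence the maps below are defined on all of C^p, and that a result lies in R^p is a
  genuine condition. An inequality x \<le> y between complex numbers is the order of
  HOL-Library.Complex_Order: equal imaginary parts and ordered real parts; in particular 0 \<le> x
  says that x is real and nonnegative.
\<close>

definition real_vecs :: "nat \<Rightarrow> complex vec set" where
  "real_vecs p = {a \<in> carrier_vec p. \<forall>k<p. a $ k \<in> \<real>}"

subsection \<open>Tubal scalars\<close>

definition phi :: "complex mat \<Rightarrow> complex vec \<Rightarrow> complex vec" where
  "phi L a = L *\<^sub>v a"

text \<open>Only meaningful for invertible L, where mat_inverse returns the inverse matrix.\<close>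

definition phi_inv :: "complex mat \<Rightarrow> complex vec \<Rightarrow> complex vec" where
  "phi_inv L a = the (mat_inverse L) *\<^sub>v a"

definition hadamard :: "complex vec \<Rightarrow> complex vec \<Rightarrow> complex vec" where
  "hadamard a b = vec (dim_vec a) (\<lambda>k. a $ k * b $ k)"

definition tmult :: "complex mat \<Rightarrow> complex vec \<Rightarrow> complex vec \<Rightarrow> complex vec" where
  "tmult L a b = phi_inv L (hadamard (phi L a) (phi L b))"

definition psi :: "complex mat \<Rightarrow> complex vec \<Rightarrow> complex vec" where
  "psi L a = phi_inv L (conjugate (phi L a))"

definition real_preserving :: "nat \<Rightarrow> complex mat \<Rightarrow> bool" where
  "real_preserving p L \<longleftrightarrow> L \<in> carrier_mat p p \<and> invertible_mat L \<and>
     (\<forall>a \<in> real_vecs p. \<forall>b \<in> real_vecs p. tmult L a b \<in> real_vecs p)"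

definition doubly_real_preserving :: "nat \<Rightarrow> complex mat \<Rightarrow> bool" where
  "doubly_real_preserving p L \<longleftrightarrow>
     real_preserving p L \<and> (\<forall>a \<in> real_vecs p. psi L a \<in> real_vecs p)"

text \<open>The unit of the ring of tubal scalars; see \<open>tunit_is_unit\<close> below.\<close>

definition tunit :: "complex mat \<Rightarrow> complex vec" where
  "tunit L = phi_inv L (vec (dim_row L) (\<lambda>k. 1))"

definition tsymmetric :: "complex mat \<Rightarrow> complex vec \<Rightarrow> bool" where
  "tsymmetric L a \<longleftrightarrow> psi L a = a"

definition tpos_semidef :: "complex mat \<Rightarrow> complex vec \<Rightarrow> bool" where
  "tpos_semidef L a \<longleftrightarrow> tsymmetric L a \<and> (\<forall>k < dim_row L. 0 \<le> phi L a $ k)"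

definition dft_mat :: "nat \<Rightarrow> complex mat" where
  "dft_mat p = mat p p (\<lambda>(i, j). exp (- 2 * of_real pi * \<i> / of_nat p) ^ (i * j))"

subsection \<open>Tubal matrices\<close>

definition tubal_mats :: "nat \<Rightarrow> nat \<Rightarrow> nat \<Rightarrow> complex vec mat set" where
  "tubal_mats p m n = {A \<in> carrier_mat m n. \<forall>i<m. \<forall>j<n. A $$ (i, j) \<in> real_vecs p}"

definition tmat_mult :: "complex mat \<Rightarrow> complex vec mat \<Rightarrow> complex vec mat \<Rightarrow> complex vec mat" where
  "tmat_mult L A B = mat (dim_row A) (dim_col B)
     (\<lambda>(i, j). finsum_vec TYPE(complex) (dim_row L)
        (\<lambda>l. tmult L (A $$ (i, l)) (B $$ (l, j))) {0..<dim_col A})"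

definition tmat_transpose :: "complex mat \<Rightarrow> complex vec mat \<Rightarrow> complex vec mat" where
  "tmat_transpose L A = mat (dim_col A) (dim_row A) (\<lambda>(i, j). psi L (A $$ (j, i)))"

definition tmat_one :: "complex mat \<Rightarrow> nat \<Rightarrow> complex vec mat" where
  "tmat_one L n = mat n n (\<lambda>(i, j). if i = j then tunit L else 0\<^sub>v (dim_row L))"

definition tmat_orthogonal :: "complex mat \<Rightarrow> nat \<Rightarrow> complex vec mat \<Rightarrow> bool" where
  "tmat_orthogonal L n U \<longleftrightarrow> U \<in> tubal_mats (dim_row L) n n \<and>
     tmat_mult L U (tmat_transpose L U) = tmat_one L n \<and>
     tmat_mult L (tmat_transpose L U) U = tmat_one L n"

definition tmat_diagonal :: "complex mat \<Rightarrow> complex vec mat \<Rightarrow> bool" where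
  "tmat_diagonal L A \<longleftrightarrow>
     (\<forall>i < dim_row A. \<forall>j < dim_col A. i \<noteq> j \<longrightarrow> A $$ (i, j) = 0\<^sub>v (dim_row L))"

definition Phi :: "complex mat \<Rightarrow> complex vec mat \<Rightarrow> nat \<Rightarrow> complex mat" where
  "Phi L A k = mat (dim_row A) (dim_col A) (\<lambda>(i, j). phi L (A $$ (i, j)) $ k)"

text \<open>
  The singular values of an m x n matrix M, in decreasing order, with multiplicity and including
  zeros: the square roots of the min m n largest eigenvalues of the n x n matrix M^* M, these
  being the roots of its characteristic polynomial with multiplicity. They are real and
  nonnegative, so taking real parts loses nothing; if n > m, the n - m eigenvalues dropped
  are zero.
\<close>

definition singular_values :: "complex mat \<Rightarrow> real list" where
  "singular_values M = take (min (dim_row M) (dim_col M)) (rev (sorted_list_of_multiset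
     (image_mset (\<lambda>x. sqrt (Re x)) (proots (char_poly (mat_adjoint M * M))))))"

definition d_vec :: "complex mat \<Rightarrow> complex vec mat \<Rightarrow> nat \<Rightarrow> complex vec" where
  "d_vec L A l = vec (dim_row L) (\<lambda>k. of_real (singular_values (Phi L A k) ! l))"

text \<open>The entries of \<open>tsvd_G L A\<close> are a priori only vectors in C^p.\<close>

definition tsvd_G :: "complex mat \<Rightarrow> complex vec mat \<Rightarrow> complex vec mat" where
  "tsvd_G L A = mat (dim_row A) (dim_col A)
     (\<lambda>(i, j). if i = j then phi_inv L (d_vec L A i) else 0\<^sub>v (dim_row L))"

definition is_tsvd ::
  "complex mat \<Rightarrow> nat \<Rightarrow> nat \<Rightarrow> complex vec mat \<Rightarrow> complex vec mat \<Rightarrow> complex vec mat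
    \<Rightarrow> complex vec mat \<Rightarrow> bool" where
  "is_tsvd L m n A U S V \<longleftrightarrow>
     tmat_orthogonal L m U \<and> tmat_orthogonal L n V \<and>
     S \<in> tubal_mats (dim_row L) m n \<and> S = tsvd_G L A \<and>
     A = tmat_mult L (tmat_mult L U S) (tmat_transpose L V)"

definition s_diagonal :: "complex mat \<Rightarrow> nat \<Rightarrow> nat \<Rightarrow> complex vec mat \<Rightarrow> bool" where
  "s_diagonal L m n A \<longleftrightarrow>
     A \<in> tubal_mats (dim_row L) m n \<and> tmat_diagonal L A \<and>
     (\<forall>i < min m n. tsymmetric L (A $$ (i, i))) \<and>
     (\<forall>i < min m n. tpos_semidef L (A $$ (i, i))) \<and>
     (\<forall>k < dim_row L. \<forall>i. Suc i < min m n \<longrightarrow>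
        phi L (A $$ (Suc i, Suc i)) $ k \<le> phi L (A $$ (i, i)) $ k)"

subsection \<open>The unit\<close>

lemma mat_inverse_props:
  fixes L :: "complex mat"
  assumes L: "L \<in> carrier_mat p p" and inv: "invertible_mat L"
  obtains M where "mat_inverse L = Some M" "M \<in> carrier_mat p p"
    "L * M = 1\<^sub>m p" "M * L = 1\<^sub>m p"
proof -
  from inv obtain B where B: "L * B = 1\<^sub>m p" "B * L = 1\<^sub>m (dim_row B)"
    using L unfolding invertible_mat_def inverts_mat_def by auto
  have "dim_col B = p" using B(1) by (metis index_mult_mat(3) index_one_mat(3))
  moreover have "dim_row B = p" using B(2) L
    by (metis carrier_matD(2) index_mult_mat(3) index_one_mat(3))
  ultimately have Bc: "B \<in> carrier_mat p p" by auto
  have "L \<in> Units (ring_mat TYPE(complex) p ())"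
    using L Bc B unfolding Units_def ring_mat_def by auto
  then have "mat_inverse L \<noteq> None" using mat_inverse(1)[OF L, of "()"] by blast
  then obtain M where "mat_inverse L = Some M" by auto
  then show thesis using mat_inverse(2)[OF L] that by blast
qed

lemma
  assumes L: "L \<in> carrier_mat p p" and inv: "invertible_mat L" and a: "a \<in> carrier_vec p"
  shows phi_phi_inv: "phi L (phi_inv L a) = a" and phi_inv_phi: "phi_inv L (phi L a) = a"
    and phi_inv_closed: "phi_inv L a \<in> carrier_vec p"
proof -
  obtain M where M: "mat_inverse L = Some M" "M \<in> carrier_mat p p"
    "L * M = 1\<^sub>m p" "M * L = 1\<^sub>m p" using mat_inverse_props[OF L inv] .
  show "phi L (phi_inv L a) = a" "phi_inv L (phi L a) = a" "phi_inv L a \<in> carrier_vec p"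
    using M L a
    by (auto simp: phi_def phi_inv_def assoc_mult_mat_vec[symmetric, of _ p p _ p])
qed

lemma tunit_mult:
  assumes L: "L \<in> carrier_mat p p" and inv: "invertible_mat L" and a: "a \<in> carrier_vec p"
  shows "tmult L (tunit L) a = a"
proof -
  have La: "phi L a \<in> carrier_vec p" using L a by (auto simp: phi_def)
  have "hadamard (vec p (\<lambda>k. 1)) (phi L a) = phi L a"
    using La by (intro eq_vecI) (auto simp: hadamard_def)
  then show ?thesis using L phi_phi_inv[OF L inv, of "vec p (\<lambda>k. 1)"] phi_inv_phi[OF L inv a]
    by (auto simp: tmult_def tunit_def)
qed

lemma tmult_commute:
  assumes L: "L \<in> carrier_mat p p"
  shows "tmult L a b = tmult L b a"
  using L by (auto simp: tmult_def hadamard_def phi_def mult.commute)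

lemma tmult_add_scaled:
  assumes L: "L \<in> carrier_mat p p" and inv: "invertible_mat L"
    and c: "u \<in> carrier_vec p" "v \<in> carrier_vec p" "b \<in> carrier_vec p"
  shows "tmult L (u + c \<cdot>\<^sub>v v) b = tmult L u b + c \<cdot>\<^sub>v tmult L v b"
    and "tmult L u b \<in> carrier_vec p"
proof -
  obtain M where M: "mat_inverse L = Some M" "M \<in> carrier_mat p p"
    using mat_inverse_props[OF L inv] .
  have h: "hadamard (phi L (u + c \<cdot>\<^sub>v v)) (phi L b)
      = hadamard (phi L u) (phi L b) + c \<cdot>\<^sub>v hadamard (phi L v) (phi L b)"
    using L c by (intro eq_vecI)
      (auto simp: hadamard_def phi_def scalar_prod_add_distrib[of _ p] algebra_simps)
  have hc: "hadamard (phi L x) (phi L b) \<in> carrier_vec p" for x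
    using L by (auto simp: hadamard_def phi_def)
  show "tmult L (u + c \<cdot>\<^sub>v v) b = tmult L u b + c \<cdot>\<^sub>v tmult L v b"
    unfolding tmult_def h using M hc[of u] hc[of v]
    by (simp add: phi_inv_def mult_add_distrib_mat_vec[of _ p p] mult_mat_vec[of _ p p])
  show "tmult L u b \<in> carrier_vec p"
    unfolding tmult_def by (rule phi_inv_closed[OF L inv hc])
qed

theorem tunit_is_unit:
  assumes rp: "real_preserving p L"
  shows "tunit L \<in> real_vecs p" and "\<forall>a \<in> real_vecs p. tmult L (tunit L) a = a"
proof -
  have L: "L \<in> carrier_mat p p" and inv: "invertible_mat L"
    and pr: "\<And>a b. a \<in> real_vecs p \<Longrightarrow> b \<in> real_vecs p \<Longrightarrow> tmult L a b \<in> real_vecs p"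
    using rp by (auto simp: real_preserving_def)
  show unit: "\<forall>a \<in> real_vecs p. tmult L (tunit L) a = a"
    using tunit_mult[OF L inv] by (auto simp: real_vecs_def)
  define e where "e = tunit L"
  have e: "e \<in> carrier_vec p" unfolding e_def tunit_def
    using L by (intro phi_inv_closed[OF L inv]) auto
  define u v where "u = vec p (\<lambda>k. of_real (Re (e $ k)) :: complex)"
    and "v = vec p (\<lambda>k. of_real (Im (e $ k)) :: complex)"
  have uv: "u \<in> real_vecs p" "v \<in> real_vecs p" by (auto simp: u_def v_def real_vecs_def)
  then have uvc: "u \<in> carrier_vec p" "v \<in> carrier_vec p" by (auto simp: real_vecs_def)
  have euv: "e = u + \<i> \<cdot>\<^sub>v v"
    using e by (intro eq_vecI) (auto simp: u_def v_def complex_eq_iff)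
  have zero: "tmult L v a = 0\<^sub>v p" if a: "a \<in> real_vecs p" for a
  proof (rule eq_vecI)
    have ac: "a \<in> carrier_vec p" using a by (auto simp: real_vecs_def)
    have eq: "a = tmult L u a + \<i> \<cdot>\<^sub>v tmult L v a"
      using unit a tmult_add_scaled(1)[OF L inv uvc ac] euv by (auto simp: e_def)
    have r: "tmult L u a \<in> real_vecs p" "tmult L v a \<in> real_vecs p" using pr uv a by auto
    show "dim_vec (tmult L v a) = dim_vec (0\<^sub>v p :: complex vec)"
      using r by (auto simp: real_vecs_def)
    fix k assume "k < dim_vec (0\<^sub>v p :: complex vec)"
    then have k: "k < p" by simp
    have ak: "a $ k = tmult L u a $ k + \<i> * tmult L v a $ k"
    proof -
      have "dim_vec (tmult L u a) = p" "dim_vec (tmult L v a) = p"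
        using r by (auto simp: real_vecs_def)
      then show ?thesis using arg_cong[OF eq, of "\<lambda>w. w $ k"] k by simp
    qed
    have "a $ k \<in> \<real>" "tmult L u a $ k \<in> \<real>" "tmult L v a $ k \<in> \<real>"
      using a r k by (auto simp: real_vecs_def)
    then have "Im (a $ k) = 0" "Im (tmult L u a $ k) = 0" "Im (tmult L v a $ k) = 0"
      by (auto simp: complex_is_Real_iff)
    then show "tmult L v a $ k = 0\<^sub>v p $ k"
      using arg_cong[OF ak, of Im] k by (simp add: complex_eq_iff)
  qed
  have "v = tmult L v e" using tunit_mult[OF L inv uvc(2)] tmult_commute[OF L] by (simp add: e_def)
  also have "\<dots> = tmult L e v" by (rule tmult_commute[OF L])
  also have "\<dots> = tmult L u v + \<i> \<cdot>\<^sub>v tmult L v v"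
    unfolding euv by (rule tmult_add_scaled(1)[OF L inv uvc uvc(2)])
  also have "\<dots> = 0\<^sub>v p"
    using zero[OF uv(1)] zero[OF uv(2)] tmult_commute[OF L, of u v] by auto
  finally have "e = u" using euv uvc by auto
  then show "tunit L \<in> real_vecs p" using uv by (simp add: e_def)
qed

end

theory Submission
  imports Defs
begin

text \<open>
  The map phi turns the tubal statement into one about ordinary matrices, one for each index
  \<open>k\<close>. The slice \<open>Phi L S k\<close> of the tubal matrix \<open>S = G(A)\<close> is the rectangular diagonal matrix
  carrying the singular values of \<open>Phi L A k\<close>, which are nonnegative and
  decreasing (\<open>singular_values_props\<close>). A
  rectangular diagonal matrix with such a diagonal has that diagonal as its list of singular
  values (\<open>singular_values_diagonal\<close>). So \<open>G\<close> reads the same vectors off \<open>S\<close> as off \<open>A\<close>, and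
  \<open>S = G(S)\<close>.

  The entries of \<open>S\<close> have phi-images with nonnegative real components, hence are fixed by
  conjugation on the phi side; this is symmetry and positive semi-definiteness, and the order of
  the singular values is the third condition of s-diagonality. That the entries of \<open>S\<close> are real
  vectors is part of the notion of a T-SVD.
\<close>

section \<open>Singular values\<close>

lemma proots_prod_list_linear:
  fixes xs :: "'a::idom list"
  shows "proots (\<Prod>x\<leftarrow>xs. [:- x, 1:]) = mset xs"
proof (induction xs)
  case (Cons x xs)
  have "(\<Prod>x\<leftarrow>xs. [:- x, 1:]) \<noteq> 0"
    by (auto simp: prod_list_zero_iff)
  then show ?case
    using Cons by (simp add: proots_mult del: mult_pCons_left)
qed simp

lemma adjoint_mult_vec_inner:
  fixes M :: "complex mat"
  assumes M: "M \<in> carrier_mat m n" and w: "w \<in> carrier_vec m" and v: "v \<in> carrier_vec n"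
  shows "(mat_adjoint M *\<^sub>v w) \<bullet>c v = w \<bullet>c (M *\<^sub>v v)"
proof -
  have "(mat_adjoint M *\<^sub>v w) \<bullet>c v = (\<Sum>j<n. (\<Sum>i<m. cnj (M $$ (i, j)) * w $ i) * cnj (v $ j))"
    using M w v by (simp add: scalar_prod_def mat_adjoint_def mat_of_rows_def atLeast0LessThan)
  also have "\<dots> = (\<Sum>j<n. \<Sum>i<m. w $ i * cnj (M $$ (i, j) * v $ j))"
    by (simp add: sum_distrib_right sum_distrib_left ac_simps)
  also have "\<dots> = (\<Sum>i<m. w $ i * cnj (\<Sum>j<n. M $$ (i, j) * v $ j))"
    by (subst sum.swap) (simp add: sum_distrib_left)
  also have "\<dots> = w \<bullet>c (M *\<^sub>v v)"
    using M w v by (simp add: scalar_prod_def atLeast0LessThan)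
  finally show ?thesis .
qed

text \<open>
  The real square root is odd, so a negative eigenvalue would produce a negative singular value.
  It is excluded by \<open>\<parallel>M v\<parallel>\<^sup>2 = \<langle>M\<^sup>* M v, v\<rangle> = x \<parallel>v\<parallel>\<^sup>2\<close> for an eigenvector \<open>v\<close>.
\<close>

lemma eigenvalue_adjoint_mult_self_nonneg:
  fixes M :: "complex mat"
  assumes M: "M \<in> carrier_mat m n" and ev: "eigenvalue (mat_adjoint M * M) x"
  shows "0 \<le> x"
proof -
  have adj: "mat_adjoint M \<in> carrier_mat n m"
    using M by (auto simp: mat_adjoint_def)
  obtain v where v: "v \<in> carrier_vec n" "v \<noteq> 0\<^sub>v n" "(mat_adjoint M * M) *\<^sub>v v = x \<cdot>\<^sub>v v"
    using ev M adj by (auto simp: eigenvalue_def eigenvector_def)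
  have Mv: "M *\<^sub>v v \<in> carrier_vec m" using M v by auto
  have "x * (v \<bullet>c v) = (x \<cdot>\<^sub>v v) \<bullet>c v"
    using v by simp
  also have "\<dots> = (mat_adjoint M *\<^sub>v (M *\<^sub>v v)) \<bullet>c v"
    using v(3) assoc_mult_mat_vec[OF adj M v(1)] by simp
  also have "\<dots> = (M *\<^sub>v v) \<bullet>c (M *\<^sub>v v)"
    by (rule adjoint_mult_vec_inner[OF M Mv v(1)])
  finally have eq: "x * (v \<bullet>c v) = (M *\<^sub>v v) \<bullet>c (M *\<^sub>v v)" .
  have "0 \<le> (M *\<^sub>v v) \<bullet>c (M *\<^sub>v v)" "0 < v \<bullet>c v"
    using v Mv conjugate_square_ge_0_vec conjugate_square_greater_0_vec by blast+
  then have sq: "0 \<le> Re ((M *\<^sub>v v) \<bullet>c (M *\<^sub>v v))" "Im ((M *\<^sub>v v) \<bullet>c (M *\<^sub>v v)) = 0"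
    and pos: "0 < Re (v \<bullet>c v)" "Im (v \<bullet>c v) = 0"
    by (simp_all add: less_eq_complex_def less_complex_def)
  have "0 \<le> Re x * Re (v \<bullet>c v)" "Im x * Re (v \<bullet>c v) = 0"
    using sq pos(2) by (simp_all flip: eq)
  then show ?thesis
    using pos(1) by (simp add: less_eq_complex_def zero_le_mult_iff)
qed

lemma singular_values_props:
  fixes M :: "complex mat"
  assumes M: "M \<in> carrier_mat m n"
  shows length_singular_values: "length (singular_values M) = min m n"
    and singular_values_nonneg: "\<And>s. s \<in> set (singular_values M) \<Longrightarrow> 0 \<le> s"
    and singular_values_decreasing: "sorted (rev (singular_values M))"
proof -
  let ?N = "mat_adjoint M * M"
  have N: "?N \<in> carrier_mat n n"
    using M by (auto simp: mat_adjoint_def)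
  obtain es where es: "char_poly ?N = (\<Prod>e\<leftarrow>es. [:- e, 1:])" "length es = n"
    using char_poly_factorized[OF N] by blast
  have roots: "proots (char_poly ?N) = mset es"
    unfolding es(1) by (rule proots_prod_list_linear)
  have sv: "singular_values M = take (min m n) (rev (sort (map (\<lambda>x. sqrt (Re x)) es)))"
    using M unfolding singular_values_def roots
    by (simp flip: mset_map sorted_list_of_multiset_mset)
  show "length (singular_values M) = min m n"
    unfolding sv using es(2) by simp
  show "0 \<le> s" if "s \<in> set (singular_values M)" for s
  proof -
    obtain e where e: "e \<in> set es" "s = sqrt (Re e)"
      using \<open>s \<in> _\<close> unfolding sv by (auto dest!: in_set_takeD)
    have "poly (char_poly ?N) e = 0"
      unfolding es(1) using e(1) by (induction es) auto
    then have "eigenvalue ?N e"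
      using eigenvalue_root_char_poly[OF N] by simp
    then show ?thesis
      using eigenvalue_adjoint_mult_self_nonneg[OF M] e(2) by (auto simp: less_eq_complex_def)
  qed
  show "sorted (rev (singular_values M))"
    unfolding sv by (simp add: rev_take)
qed

text \<open>
  Here \<open>M\<^sup>* M\<close> is diagonal with the entries \<open>d\<^sup>2\<close> followed by zeros if \<open>n > m\<close>, and in this order
  the square roots of its eigenvalues are already decreasing; truncation removes the zeros.
\<close>

lemma singular_values_diagonal:
  fixes ds :: "real list"
  assumes len: "length ds = min m n"
    and nonneg: "\<And>d. d \<in> set ds \<Longrightarrow> 0 \<le> d" and decreasing: "sorted (rev ds)"
  shows "singular_values (mat m n (\<lambda>(i, j). if i = j then of_real (ds ! i) else 0)) = ds"
proof -
  define M :: "complex mat" where "M = mat m n (\<lambda>(i, j). if i = j then of_real (ds ! i) else 0)"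
  let ?N = "mat_adjoint M * M"
  have M: "M \<in> carrier_mat m n" by (simp add: M_def)
  define xs where "xs = ds @ replicate (n - m) 0"
  have len_xs: "length xs = n" using len by (simp add: xs_def)
  have entry: "?N $$ (i, j) = (if i = j then of_real ((xs ! i)\<^sup>2) else 0)"
    if ij: "i < n" "j < n" for i j
  proof -
    have "?N $$ (i, j) = (\<Sum>l<m. cnj (M $$ (l, i)) * M $$ (l, j))"
      using M ij by (simp add: mat_adjoint_def scalar_prod_def atLeast0LessThan mat_of_rows_def)
    also have "\<dots> = (\<Sum>l<m. if l = i then (if i = j then of_real ((ds ! i)\<^sup>2) else 0) else 0)"
      using ij by (intro sum.cong) (auto simp: M_def power2_eq_square)
    also have "\<dots> = (if i = j then of_real ((xs ! i)\<^sup>2) else 0)"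
      using ij len by (auto simp: xs_def nth_append)
    finally show ?thesis .
  qed
  have N: "?N \<in> carrier_mat n n"
    using M by (auto simp: mat_adjoint_def)
  have "upper_triangular ?N"
    using N entry by (auto simp: upper_triangular_def)
  moreover have "diag_mat ?N = map (\<lambda>x. of_real (x\<^sup>2)) xs"
    using N entry len_xs by (intro nth_equalityI) (auto simp: diag_mat_def)
  ultimately have "char_poly ?N = (\<Prod>x\<leftarrow>map (\<lambda>x. of_real (x\<^sup>2)) xs. [:- x, 1:])"
    using char_poly_upper_triangular[OF N] by simp
  then have roots: "proots (char_poly ?N) = mset (map (\<lambda>x. of_real (x\<^sup>2)) xs)"
    by (simp only: proots_prod_list_linear)
  have "map (\<lambda>x. sqrt (Re x)) (map (\<lambda>x. of_real (x\<^sup>2)) xs) = xs"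
    using nonneg by (auto simp: xs_def intro!: map_idI)
  then have "image_mset (\<lambda>x. sqrt (Re x)) (proots (char_poly ?N)) = mset xs"
    unfolding roots mset_map[symmetric] by simp
  moreover have "sort xs = rev xs"
    using nonneg decreasing
    by (intro properties_for_sort) (auto simp: xs_def sorted_append)
  ultimately have "singular_values M = take (min m n) xs"
    using M unfolding singular_values_def by (simp add: sorted_list_of_multiset_mset)
  then show ?thesis
    using len by (simp add: xs_def M_def)
qed

section \<open>The slices of G\<close>

lemma phi_zero:
  assumes "L \<in> carrier_mat p p"
  shows "phi L (0\<^sub>v p) = 0\<^sub>v p"
  using assms by (auto simp: phi_def)

lemma phi_tsvd_G_diag:
  assumes L: "L \<in> carrier_mat p p" and inv: "invertible_mat L"
    and i: "i < dim_row A" "i < dim_col A"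
  shows "phi L (tsvd_G L A $$ (i, i)) = d_vec L A i"
  using i L phi_phi_inv[OF L inv] by (simp add: tsvd_G_def d_vec_def)

lemma Phi_tsvd_G:
  assumes L: "L \<in> carrier_mat p p" and inv: "invertible_mat L" and k: "k < p"
  shows "Phi L (tsvd_G L A) k = mat (dim_row A) (dim_col A)
    (\<lambda>(i, j). if i = j then of_real (singular_values (Phi L A k) ! i) else 0)"
proof (rule eq_matI)
  fix i j
  assume "i < dim_row (mat (dim_row A) (dim_col A)
      (\<lambda>(i, j). if i = j then complex_of_real (singular_values (Phi L A k) ! i) else 0))"
    and "j < dim_col (mat (dim_row A) (dim_col A)
      (\<lambda>(i, j). if i = j then complex_of_real (singular_values (Phi L A k) ! i) else 0))"
  then have ij: "i < dim_row A" "j < dim_col A" by auto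
  show "Phi L (tsvd_G L A) k $$ (i, j) = mat (dim_row A) (dim_col A)
    (\<lambda>(i, j). if i = j then of_real (singular_values (Phi L A k) ! i) else 0) $$ (i, j)"
  proof (cases "i = j")
    case True
    then show ?thesis
      using ij k L phi_tsvd_G_diag[OF L inv, of i A]
      by (simp add: Phi_def d_vec_def) (simp add: tsvd_G_def)
  next
    case False
    then show ?thesis
      using ij k L phi_zero[OF L] by (simp add: Phi_def tsvd_G_def)
  qed
qed (auto simp: Phi_def tsvd_G_def)

lemma singular_values_Phi_tsvd_G:
  assumes L: "L \<in> carrier_mat p p" and inv: "invertible_mat L" and k: "k < p"
  shows "singular_values (Phi L (tsvd_G L A) k) = singular_values (Phi L A k)"
proof -
  have c: "Phi L A k \<in> carrier_mat (dim_row A) (dim_col A)" by (simp add: Phi_def)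
  show ?thesis
    unfolding Phi_tsvd_G[OF L inv k]
    by (rule singular_values_diagonal[OF singular_values_props[OF c]])
qed

lemma tsvd_G_idempotent:
  assumes L: "L \<in> carrier_mat p p" and inv: "invertible_mat L"
  shows "tsvd_G L (tsvd_G L A) = tsvd_G L A"
proof -
  let ?S = "tsvd_G L A"
  have d: "d_vec L ?S i = d_vec L A i" for i
    using L singular_values_Phi_tsvd_G[OF L inv] by (auto simp: d_vec_def)
  have dims: "dim_row ?S = dim_row A" "dim_col ?S = dim_col A"
    by (auto simp: tsvd_G_def)
  have "tsvd_G L ?S = mat (dim_row ?S) (dim_col ?S)
      (\<lambda>(i, j). if i = j then phi_inv L (d_vec L ?S i) else 0\<^sub>v (dim_row L))"
    by (rule tsvd_G_def)
  also have "\<dots> = ?S"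
    unfolding d dims by (rule tsvd_G_def[symmetric])
  finally show ?thesis .
qed

text \<open>
  Inverting the transform may take the nonnegative vectors \<open>d_vec L A i\<close> outside \<open>\<real>\<^sup>p\<close>, so
  membership of \<open>G(A)\<close> in the tubal matrices is a hypothesis. Symmetry, semi-definiteness and the
  order of the diagonal are read off from these vectors.
\<close>

lemma s_diagonal_tsvd_G:
  assumes L: "L \<in> carrier_mat p p" and inv: "invertible_mat L"
    and A: "A \<in> carrier_mat m n" and real: "tsvd_G L A \<in> tubal_mats p m n"
  shows "s_diagonal L m n (tsvd_G L A)"
proof -
  have c: "Phi L A k \<in> carrier_mat m n" for k using A by (simp add: Phi_def)
  have diag: "phi L (tsvd_G L A $$ (i, i)) = d_vec L A i" if "i < min m n" for i
    using phi_tsvd_G_diag[OF L inv] A that by auto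
  have sym: "tsymmetric L (tsvd_G L A $$ (i, i))" if i: "i < min m n" for i
  proof -
    have "conjugate (d_vec L A i) = d_vec L A i"
      by (intro eq_vecI) (auto simp: d_vec_def)
    then have "psi L (tsvd_G L A $$ (i, i)) = phi_inv L (d_vec L A i)"
      by (simp add: psi_def diag[OF i])
    also have "\<dots> = tsvd_G L A $$ (i, i)"
      using A i by (simp add: tsvd_G_def)
    finally show ?thesis by (simp add: tsymmetric_def)
  qed
  have nonneg: "0 \<le> d_vec L A i $ k" if "i < min m n" "k < p" for i k
    using that L length_singular_values[OF c]
    by (auto simp: d_vec_def less_eq_complex_def intro!: singular_values_nonneg[OF c] nth_mem)
  have decr: "d_vec L A (Suc i) $ k \<le> d_vec L A i $ k" if "Suc i < min m n" "k < p" for i k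
    using that L sorted_rev_nth_mono[OF singular_values_decreasing[OF c], of i "Suc i"]
      length_singular_values[OF c]
    by (simp add: d_vec_def less_eq_complex_def)
  have "tmat_diagonal L (tsvd_G L A)"
    by (auto simp: tmat_diagonal_def tsvd_G_def)
  then show ?thesis
    using real L sym nonneg decr diag by (auto simp: s_diagonal_def tpos_semidef_def)
qed

theorem theorem2p13:
  fixes m n p :: nat and L :: "complex mat" and A U S V :: "complex vec mat"
  assumes "m > 0" and "n > 0" and "p > 0"
    and "doubly_real_preserving p L"
    and "A \<in> tubal_mats p m n"
    and "is_tsvd L m n A U S V"
  shows "S = tsvd_G L S \<and>
    ((L = dft_mat p \<or> elements_mat L \<subseteq> \<real>) \<longrightarrow> s_diagonal L m n S)"
proof -
  have L: "L \<in> carrier_mat p p" and inv: "invertible_mat L"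
    using assms(4) by (auto simp: doubly_real_preserving_def real_preserving_def)
  have A: "A \<in> carrier_mat m n"
    using assms(5) by (simp add: tubal_mats_def)
  have S: "S = tsvd_G L A"
    using assms(6) unfolding is_tsvd_def by blast
  have "S \<in> tubal_mats (dim_row L) m n"
    using assms(6) unfolding is_tsvd_def by blast
  then have "tsvd_G L A \<in> tubal_mats p m n"
    using L S by simp
  have "tsvd_G L S = S"
    unfolding S by (rule tsvd_G_idempotent[OF L inv])
  moreover have "s_diagonal L m n S"
    using \<open>tsvd_G L A \<in> tubal_mats p m n\<close> unfolding S by (rule s_diagonal_tsvd_G[OF L inv A])
  ultimately show ?thesis by simp
qed

end
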